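(* Let $(\hat c_n)_{n\ge 0}$, $(\hat d_m)_{m\ge 0}$, $(\hat a_{n+1})_{n\ge 0}$, $(\hat b_{m+1})_{m\ge 0}$ be sequences of complex numbers that correspond to a perfect system $(f_1,f_2)$. Then the boundary value problem consisting of the difference equations $$c_{n,m+1}=c_{n,m}+\frac{(a+b)_{n+1,m}-(a+b)_{n,m+1}}{(c-d)_{n,m}},\qquad d_{n+1,m}=d_{n,m}+\frac{(a+b)_{n+1,m}-(a+b)_{n,m+1}}{(c-d)_{n,m}}\qquad(n,m\ge 0),$$ $$a_{n,m+1}=a_{n,m}\frac{(c-d)_{n,m}}{(c-d)_{n-1,m}}\quad(n\ge 1,\ m\ge 0),\qquad b_{n+1,m}=b_{n,m}\frac{(c-d)_{n,m}}{(c-d)_{n,m-1}}\quad(n\ge 0,\ m\ge 1),$$ and the boundary conditions $$a_{0,m}=0,\quad d_{0,m}=\hat d_m,\quad b_{0,m+1}=\hat b_{m+1}\quad(m\ge 0),\qquad b_{n,0}=0,\quad c_{n,0}=\hat c_n,\quad a_{n+1,0}=\hat a_{n+1}\quad(n\ge 0),$$ has a solution, and it satisfies $$a_{n+1,0}=\hat a_{n+1}\neq 0,\qquad b_{0,m+1}=\hat b_{m+1}\neq 0\qquad (n,m\ge 0).$$ Moreover, the boundary data $\hat c_n,\hat d_m,\hat a_{n+1},\hat b_{m+1}$ determine the moments $s_{1,k},s_{2,k}$ ($k\ge 0$) of $f_1,f_2$, and the solution $(a_{n,m},b_{n,m},c_{n,m},d_{n,m})_{n,m\ge 0}$ is determined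 by these moments.
   Context: $\mathbb{Z}_+=\{0,1,2,\dots\}$. Notation: $(a+b)_{n,m}=a_{n,m}+b_{n,m}$, $(c-d)_{n,m}=c_{n,m}-d_{n,m}$; a solution consists of complex arrays for which all denominators $(c-d)_{n,m}$ are nonzero. Let $f_j(z)=\sum_{k\ge 0}s_{j,k}z^{-k-1}$, $j=1,2$, be (formal) Laurent series at infinity with complex coefficients; the $s_{j,k}$ are called the moments. For $(n_1,n_2)\in\mathbb{Z}_+^2$, a (type II) Hermite-Padé polynomial for $(f_1,f_2)$ is a nonzero polynomial $P_{n_1,n_2}$ with $\deg P_{n_1,n_2}\le n_1+n_2$ such that for $j=1,2$ there is a polynomial $Q^{(j)}$ with $f_j(z)P_{n_1,n_2}(z)-Q^{(j)}(z)=\mathcal{O}(z^{-n_j-1})$ as $z\to\infty$. The index $(n_1,n_2)$ is normal if $P_{n_1,n_2}$ is unique up to a multiplicative constant and every nontrivial solution has full degree $n_1+n_2$. The system $(f_1,f_2)$ is perfect if all indices in $\mathbb{Z}_+^2$ are normal. The data $\hat c_n,\hat d_m,\hat a_{n+1},\hat b_{m+1}$ correspond to the perfect system $(f_1,f_2)$ if they are the entries of the $J$-fraction representations (with nonzero partial numerators) $$f_1(z)\sim-\cfrac{1}{z-\hat c_0-\cfrac{\hat a_1}{z-\hat c_1-\cfrac{\hat a_2}{\ddots}}},\qquad f_2(z)\sim-\cfrac{1}{z-\hat d_0-\cfrac{\hat b_1}{z-\hat d_1-\cfrac{\hat b_2}{\ddots}}},$$ where $\sim$ means equality of formal Laurent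 series at infinity. *)

theory Defs
  imports Complex_Main "HOL-Computational_Algebra.Computational_Algebra"
begin

text \<open>
  Laurent series at infinity are elements of \<^typ>\<open>complex fls\<close> whose formal variable stands for
  \<open>1 / z\<close>. Thus \<open>z\<close> itself is \<^const>\<open>fls_X_inv\<close>, and the coefficient of \<open>z\<close> to the power \<open>- k\<close>
  is the coefficient with index \<open>k\<close>.
\<close>

definition poly_at_inf :: "complex poly \<Rightarrow> complex fls" where
  "poly_at_inf p = poly (map_poly fls_const p) fls_X_inv"

text \<open>The series \<open>f(z) = (\<Sum>k. s k / z ^ (k + 1))\<close> with moments \<open>s\<close>.\<close>

definition moment_series :: "(nat \<Rightarrow> complex) \<Rightarrow> complex fls" where
  "moment_series s = fps_to_fls (fps_X * Abs_fps s)"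

text \<open>\<open>f = O(1 / z ^ k)\<close> as \<open>z\<close> tends to infinity.\<close>

definition bigo_at_inf :: "complex fls \<Rightarrow> nat \<Rightarrow> bool" where
  "bigo_at_inf f k \<longleftrightarrow> (\<forall>i < int k. fls_nth f i = 0)"

definition hermite_pade ::
  "(nat \<Rightarrow> complex) \<Rightarrow> (nat \<Rightarrow> complex) \<Rightarrow> nat \<Rightarrow> nat \<Rightarrow> complex poly \<Rightarrow> bool" where
  "hermite_pade s1 s2 n1 n2 P \<longleftrightarrow>
     P \<noteq> 0 \<and> degree P \<le> n1 + n2 \<and>
     (\<exists>Q. bigo_at_inf (moment_series s1 * poly_at_inf P - poly_at_inf Q) (n1 + 1)) \<and>
     (\<exists>Q. bigo_at_inf (moment_series s2 * poly_at_inf P - poly_at_inf Q) (n2 + 1))"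

text \<open>
  Existence of a Hermite--Pade polynomial is not part of the definition: it always holds, because
  the conditions are \<open>n1 + n2\<close> homogeneous linear equations for \<open>n1 + n2 + 1\<close> coefficients.
\<close>

definition normal_index ::
  "(nat \<Rightarrow> complex) \<Rightarrow> (nat \<Rightarrow> complex) \<Rightarrow> nat \<Rightarrow> nat \<Rightarrow> bool" where
  "normal_index s1 s2 n1 n2 \<longleftrightarrow>
     (\<forall>P P'. hermite_pade s1 s2 n1 n2 P \<and> hermite_pade s1 s2 n1 n2 P' \<longrightarrow> (\<exists>r. P' = smult r P)) \<and>
     (\<forall>P. hermite_pade s1 s2 n1 n2 P \<longrightarrow> degree P = n1 + n2)"

definition perfect_system :: "(nat \<Rightarrow> complex) \<Rightarrow> (nat \<Rightarrow> complex) \<Rightarrow> bool" where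
  "perfect_system s1 s2 \<longleftrightarrow> (\<forall>n1 n2. normal_index s1 s2 n1 n2)"

text \<open>
  \<open>jfrac c a k n\<close> is the finite J-fraction with \<open>n\<close> levels
  \<open>1 / (z - c k - a (k+1) / (z - c (k+1) - \<dots> - a (k+n-1) / (z - c (k+n-1))))\<close>,
  expanded at infinity.
\<close>

primrec jfrac ::
  "(nat \<Rightarrow> complex) \<Rightarrow> (nat \<Rightarrow> complex) \<Rightarrow> nat \<Rightarrow> nat \<Rightarrow> complex fls" where
  "jfrac c a k 0 = 0"
| "jfrac c a k (Suc n) =
     1 / (fls_X_inv - fls_const (c k) - fls_const (a (Suc k)) * jfrac c a (Suc k) n)"

text \<open>
  An infinite J-fraction equals a formal Laurent series if its convergents tend to that series
  in the metric of \<^typ>\<open>complex fls\<close>, that is, if each coefficient of the convergents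
  eventually agrees with that of the series. The entry \<open>a 0\<close> plays no role.
\<close>

definition jfraction_rep ::
  "(nat \<Rightarrow> complex) \<Rightarrow> (nat \<Rightarrow> complex) \<Rightarrow> (nat \<Rightarrow> complex) \<Rightarrow> bool" where
  "jfraction_rep s c a \<longleftrightarrow>
     (\<forall>n. a (Suc n) \<noteq> 0) \<and> (\<lambda>n. - jfrac c a 0 n) \<longlonglongrightarrow> moment_series s"

definition corresponds_to_perfect_system ::
  "(nat \<Rightarrow> complex) \<Rightarrow> (nat \<Rightarrow> complex) \<Rightarrow> (nat \<Rightarrow> complex) \<Rightarrow> (nat \<Rightarrow> complex) \<Rightarrow>
   (nat \<Rightarrow> complex) \<Rightarrow> (nat \<Rightarrow> complex) \<Rightarrow> bool" where
  "corresponds_to_perfect_system chat dhat ahat bhat s1 s2 \<longleftrightarrow>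
     perfect_system s1 s2 \<and> jfraction_rep s1 chat ahat \<and> jfraction_rep s2 dhat bhat"

definition difference_equations ::
  "(nat \<Rightarrow> nat \<Rightarrow> complex) \<Rightarrow> (nat \<Rightarrow> nat \<Rightarrow> complex) \<Rightarrow>
   (nat \<Rightarrow> nat \<Rightarrow> complex) \<Rightarrow> (nat \<Rightarrow> nat \<Rightarrow> complex) \<Rightarrow> bool" where
  "difference_equations a b c d \<longleftrightarrow>
     (\<forall>n m. c n m - d n m \<noteq> 0) \<and>
     (\<forall>n m. c n (m + 1) = c n m +
        ((a (n + 1) m + b (n + 1) m) - (a n (m + 1) + b n (m + 1))) / (c n m - d n m)) \<and>
     (\<forall>n m. d (n + 1) m = d n m +
        ((a (n + 1) m + b (n + 1) m) - (a n (m + 1) + b n (m + 1))) / (c n m - d n m)) \<and>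
     (\<forall>n\<ge>1. \<forall>m. a n (m + 1) = a n m * (c n m - d n m) / (c (n - 1) m - d (n - 1) m)) \<and>
     (\<forall>n. \<forall>m\<ge>1. b (n + 1) m = b n m * (c n m - d n m) / (c n (m - 1) - d n (m - 1)))"

definition boundary_conditions ::
  "(nat \<Rightarrow> complex) \<Rightarrow> (nat \<Rightarrow> complex) \<Rightarrow> (nat \<Rightarrow> complex) \<Rightarrow> (nat \<Rightarrow> complex) \<Rightarrow>
   (nat \<Rightarrow> nat \<Rightarrow> complex) \<Rightarrow> (nat \<Rightarrow> nat \<Rightarrow> complex) \<Rightarrow>
   (nat \<Rightarrow> nat \<Rightarrow> complex) \<Rightarrow> (nat \<Rightarrow> nat \<Rightarrow> complex) \<Rightarrow> bool" where
  "boundary_conditions chat dhat ahat bhat a b c d \<longleftrightarrow>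
     (\<forall>m. a 0 m = 0 \<and> d 0 m = dhat m \<and> b 0 (m + 1) = bhat (m + 1)) \<and>
     (\<forall>n. b n 0 = 0 \<and> c n 0 = chat n \<and> a (n + 1) 0 = ahat (n + 1))"

definition bvp_solution ::
  "(nat \<Rightarrow> complex) \<Rightarrow> (nat \<Rightarrow> complex) \<Rightarrow> (nat \<Rightarrow> complex) \<Rightarrow> (nat \<Rightarrow> complex) \<Rightarrow>
   (nat \<Rightarrow> nat \<Rightarrow> complex) \<Rightarrow> (nat \<Rightarrow> nat \<Rightarrow> complex) \<Rightarrow>
   (nat \<Rightarrow> nat \<Rightarrow> complex) \<Rightarrow> (nat \<Rightarrow> nat \<Rightarrow> complex) \<Rightarrow> bool" where
  "bvp_solution chat dhat ahat bhat a b c d \<longleftrightarrow>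
     difference_equations a b c d \<and> boundary_conditions chat dhat ahat bhat a b c d"

end

theory Submission
  imports Defs
begin

text \<open>
  Let \<open>L\<^sub>j\<close> be the linear functional on polynomials that sends \<open>z\<^sup>k\<close> to the moment \<open>s\<^sub>j\<^sub>,\<^sub>k\<close>. The
  coefficient of \<open>z\<^sup>-\<^sup>k\<^sup>-\<^sup>1\<close> in \<open>f\<^sub>j P\<close> is \<open>L\<^sub>j (z\<^sup>k P)\<close>, so Hermite--Pade polynomials are
  multiple orthogonal polynomials: \<open>L\<^sub>1 (z\<^sup>k P) = 0\<close> for \<open>k < n\<close> and \<open>L\<^sub>2 (z\<^sup>k P) = 0\<close> for \<open>k < m\<close>
  (\<open>orthogonal_iff\<close>). Perfectness enters through one consequence only: a polynomial of degree
  less than \<open>n + m\<close> that is orthogonal for the index \<open>(n, m)\<close> vanishes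
  (\<open>perfect_orthogonal_imp_0\<close>). Hence the monic orthogonal polynomial \<open>P\<^sub>n\<^sub>,\<^sub>m\<close> is unique, and
  \<open>h\<^sub>n\<^sub>,\<^sub>m = L\<^sub>1 (z\<^sup>n P\<^sub>n\<^sub>,\<^sub>m)\<close> is nonzero.

  The solution of the boundary value problem consists of the coefficients of the nearest
  neighbour recurrences (\<open>mop_recurrence\<close>)
  \<open>z P\<^sub>n\<^sub>,\<^sub>m = P\<^sub>n\<^sub>+\<^sub>1\<^sub>,\<^sub>m + c\<^sub>n\<^sub>,\<^sub>m P\<^sub>n\<^sub>,\<^sub>m + a\<^sub>n\<^sub>,\<^sub>m P\<^sub>n\<^sub>-\<^sub>1\<^sub>,\<^sub>m + b\<^sub>n\<^sub>,\<^sub>m P\<^sub>n\<^sub>,\<^sub>m\<^sub>-\<^sub>1\<close> and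
  \<open>z P\<^sub>n\<^sub>,\<^sub>m = P\<^sub>n\<^sub>,\<^sub>m\<^sub>+\<^sub>1 + d\<^sub>n\<^sub>,\<^sub>m P\<^sub>n\<^sub>,\<^sub>m + a\<^sub>n\<^sub>,\<^sub>m P\<^sub>n\<^sub>-\<^sub>1\<^sub>,\<^sub>m + b\<^sub>n\<^sub>,\<^sub>m P\<^sub>n\<^sub>,\<^sub>m\<^sub>-\<^sub>1\<close>.
  Subtracting them gives \<open>P\<^sub>n\<^sub>,\<^sub>m\<^sub>+\<^sub>1 - P\<^sub>n\<^sub>+\<^sub>1\<^sub>,\<^sub>m = (c - d)\<^sub>n\<^sub>,\<^sub>m P\<^sub>n\<^sub>,\<^sub>m\<close>, and pairing this with \<open>z\<^sup>n\<close>
  under \<open>L\<^sub>1\<close> gives \<open>h\<^sub>n\<^sub>,\<^sub>m\<^sub>+\<^sub>1 = (c - d)\<^sub>n\<^sub>,\<^sub>m h\<^sub>n\<^sub>,\<^sub>m\<close>. So \<open>c - d\<close> never vanishes, and since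
  \<open>a\<^sub>n\<^sub>,\<^sub>m = h\<^sub>n\<^sub>,\<^sub>m / h\<^sub>n\<^sub>-\<^sub>1\<^sub>,\<^sub>m\<close> the equation for \<open>a\<close> follows; exchanging the roles of the two series
  gives the equation for \<open>b\<close>. The equations for \<open>c\<close> and \<open>d\<close> come from comparing the second and
  third highest coefficients in the recurrences (\<open>nn_c_d_equations\<close>).

  On the boundary \<open>m = 0\<close> the recurrence has three terms. The denominator of the \<open>n\<close>-th convergent
  of the J-fraction of \<open>f\<^sub>1\<close> is orthogonal because the convergent agrees with \<open>f\<^sub>1\<close> up to
  \<open>O(z\<^sup>-\<^sup>2\<^sup>n\<^sup>-\<^sup>1)\<close>; therefore it is \<open>P\<^sub>n\<^sub>,\<^sub>0\<close>, and the entries of the J-fraction are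
  the recurrence coefficients (\<open>nn_boundary\<close>). This proves the boundary conditions and also
  shows that the moments determine the boundary data. Conversely the data determine the moments
  because limits are unique, and they determine the solution because the difference equations
  compute it antidiagonal by antidiagonal (\<open>bvp_solution_unique\<close>).
\<close>

section \<open>Polynomials as series at infinity\<close>

lemma poly_at_inf_0 [simp]: "poly_at_inf 0 = 0"
  by (simp add: poly_at_inf_def)

lemma poly_at_inf_pCons: "poly_at_inf (pCons a p) = fls_const a + fls_X_inv * poly_at_inf p"
  by (cases "a = 0 \<and> p = 0") (auto simp: poly_at_inf_def map_poly_pCons)

lemma poly_at_inf_nth:
  "fls_nth (poly_at_inf p) i = (if i \<le> 0 then coeff p (nat (- i)) else 0)"
proof (induction p arbitrary: i)
  case 0
  then show ?case by simp
next
  case (pCons a p)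
  have "nat (- i) = Suc (nat (- i - 1))" if "i < 0"
    using that by simp
  then show ?case
    by (auto simp: poly_at_inf_pCons fls_X_inv_times_conv_shift pCons.IH coeff_pCons
        split: nat.splits)
qed

lemma poly_at_inf_add: "poly_at_inf (p + q) = poly_at_inf p + poly_at_inf q"
  by (intro fls_eqI) (simp add: poly_at_inf_nth)

lemma poly_at_inf_diff: "poly_at_inf (p - q) = poly_at_inf p - poly_at_inf q"
  by (intro fls_eqI) (simp add: poly_at_inf_nth)

lemma poly_at_inf_smult: "poly_at_inf (smult r p) = fls_const r * poly_at_inf p"
  by (intro fls_eqI) (simp add: poly_at_inf_nth)

lemma poly_at_inf_linear_mult:
  "poly_at_inf ([:- r, 1:] * p) = (fls_X_inv - fls_const r) * poly_at_inf p"
  by (simp add: poly_at_inf_add poly_at_inf_diff poly_at_inf_smult poly_at_inf_pCons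
      algebra_simps fls_const_uminus)

lemma exists_polynomial_part:
  "\<exists>Q. \<forall>i\<le>0. fls_nth (g - poly_at_inf Q) i = 0"
proof -
  have "\<forall>n. n > nat (- fls_subdegree g) \<longrightarrow> fls_nth g (- int n) = 0"
    by (auto intro!: fls_eq0_below_subdegree)
  then have "coeff (Abs_poly (\<lambda>n. fls_nth g (- int n))) = (\<lambda>n. fls_nth g (- int n))"
    by (intro Abs_poly_inverse) (auto simp only: mem_Collect_eq MOST_nat)
  then show ?thesis
    by (intro exI[of _ "Abs_poly (\<lambda>n. fls_nth g (- int n))"]) (simp add: poly_at_inf_nth)
qed


section \<open>Orthogonality\<close>

text \<open>
  This is \<open>L (z\<^sup>k p)\<close> for the functional \<open>L\<close> with moments \<open>s\<close>. Reading it off as a coefficient of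
  \<open>f p\<close> makes linearity in \<open>p\<close> and the rule for multiplication by \<open>z\<close> immediate.
\<close>

definition moment_pairing :: "(nat \<Rightarrow> complex) \<Rightarrow> nat \<Rightarrow> complex poly \<Rightarrow> complex" where
  "moment_pairing s k p = fls_nth (moment_series s * poly_at_inf p) (int k + 1)"

lemma moment_pairing_diff:
  "moment_pairing s k (p - q) = moment_pairing s k p - moment_pairing s k q"
  by (simp add: moment_pairing_def poly_at_inf_diff algebra_simps)

lemma moment_pairing_smult: "moment_pairing s k (smult r p) = r * moment_pairing s k p"
  by (simp add: moment_pairing_def poly_at_inf_smult mult.left_commute[of _ "fls_const r"])

lemma moment_pairing_shift: "moment_pairing s k (pCons 0 p) = moment_pairing s (Suc k) p"
proof -
  have "moment_series s * poly_at_inf (pCons 0 p)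
      = fls_X_inv * (moment_series s * poly_at_inf p)"
    by (simp add: poly_at_inf_pCons mult.left_commute)
  then show ?thesis
    by (simp add: moment_pairing_def fls_X_inv_times_conv_shift add.commute)
qed

lemmas moment_pairing_simps =
  moment_pairing_diff moment_pairing_smult moment_pairing_shift

definition orthogonal :: "(nat \<Rightarrow> complex) \<Rightarrow> nat \<Rightarrow> complex poly \<Rightarrow> bool" where
  "orthogonal s n p \<longleftrightarrow> (\<forall>k<n. moment_pairing s k p = 0)"

text \<open>
  The polynomial \<open>Q\<close> can always be chosen to cancel the nonnegative powers of \<open>z\<close>, and it has no
  effect on the negative ones, which are the moment pairings.
\<close>

lemma orthogonal_iff:
  "orthogonal s n p \<longleftrightarrow>
     (\<exists>Q. bigo_at_inf (moment_series s * poly_at_inf p - poly_at_inf Q) (n + 1))"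
proof
  assume orth: "orthogonal s n p"
  obtain Q where Q: "\<And>i. i \<le> 0 \<Longrightarrow>
      fls_nth (moment_series s * poly_at_inf p - poly_at_inf Q) i = 0"
    using exists_polynomial_part by blast
  have "fls_nth (moment_series s * poly_at_inf p - poly_at_inf Q) i = 0"
    if "i < int (n + 1)" for i
  proof (cases "i \<le> 0")
    case False
    define k where "k = nat (i - 1)"
    have k: "k < n" "i = int k + 1"
      using False that by (auto simp: k_def)
    then have "moment_pairing s k p = 0"
      using orth by (simp add: orthogonal_def)
    then show ?thesis
      using k(2) by (simp add: moment_pairing_def poly_at_inf_nth)
  qed (use Q in simp)
  then show "\<exists>Q. bigo_at_inf (moment_series s * poly_at_inf p - poly_at_inf Q) (n + 1)"
    unfolding bigo_at_inf_def by blast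
next
  assume "\<exists>Q. bigo_at_inf (moment_series s * poly_at_inf p - poly_at_inf Q) (n + 1)"
  then obtain Q where
    Q: "\<And>i. i < int (n + 1) \<Longrightarrow> fls_nth (moment_series s * poly_at_inf p - poly_at_inf Q) i = 0"
    unfolding bigo_at_inf_def by blast
  show "orthogonal s n p"
    unfolding orthogonal_def
  proof (intro allI impI)
    fix k assume "k < n"
    then show "moment_pairing s k p = 0"
      using Q[of "int k + 1"] by (simp add: moment_pairing_def poly_at_inf_nth)
  qed
qed

text \<open>
  A nonzero \<open>p\<close> would be a Hermite--Pade polynomial that fails to have full degree.
\<close>

lemma perfect_orthogonal_imp_0:
  assumes "perfect_system s1 s2" "orthogonal s1 n p" "orthogonal s2 m p" "degree p < n + m"
  shows "p = 0"
  using assms unfolding perfect_system_def normal_index_def hermite_pade_def orthogonal_iff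
  by (metis less_imp_le nat_neq_iff)

lemma perfect_system_swap: "perfect_system s1 s2 \<Longrightarrow> perfect_system s2 s1"
  unfolding perfect_system_def normal_index_def hermite_pade_def
  by (metis add.commute)

text \<open>Type II multiple orthogonal polynomials, normalised to be monic of degree \<open>n + m\<close>.\<close>

definition monic_mop ::
  "(nat \<Rightarrow> complex) \<Rightarrow> (nat \<Rightarrow> complex) \<Rightarrow> nat \<Rightarrow> nat \<Rightarrow> complex poly \<Rightarrow> bool" where
  "monic_mop s1 s2 n m p \<longleftrightarrow>
     degree p \<le> n + m \<and> coeff p (n + m) = 1 \<and> orthogonal s1 n p \<and> orthogonal s2 m p"

lemma degree_less_of_coeff_0:
  assumes "degree p \<le> N" "coeff p N = 0" "0 < N \<or> p \<noteq> 0"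
  shows "degree p < N"
  using assms by (metis leading_coeff_0_iff le_neq_implies_less degree_0)

lemma monic_mop_swap: "monic_mop s1 s2 n m p \<longleftrightarrow> monic_mop s2 s1 m n p"
  by (auto simp: monic_mop_def add.commute)

lemma monic_mop_unique:
  assumes "perfect_system s1 s2" "monic_mop s1 s2 n m p" "monic_mop s1 s2 n m q"
  shows "p = q"
proof (rule ccontr)
  assume ne: "p \<noteq> q"
  have "degree (p - q) \<le> n + m"
    using assms(2,3) by (auto simp: monic_mop_def intro: degree_diff_le)
  moreover have "coeff (p - q) (n + m) = 0"
    using assms(2,3) by (auto simp: monic_mop_def)
  ultimately have "degree (p - q) < n + m"
    using ne by (intro degree_less_of_coeff_0) auto
  moreover have "orthogonal s1 n (p - q)" "orthogonal s2 m (p - q)"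
    using assms(2,3) by (auto simp: monic_mop_def orthogonal_def moment_pairing_simps)
  ultimately have "p - q = 0"
    using perfect_orthogonal_imp_0[OF assms(1)] by blast
  with ne show False by simp
qed

text \<open>
  If the pairing vanished, \<open>p\<close> would be orthogonal for the index \<open>(n + 1, m)\<close> with too small a
  degree.
\<close>

lemma monic_mop_pairing_nonzero:
  assumes "perfect_system s1 s2" "monic_mop s1 s2 n m p"
  shows "moment_pairing s1 n p \<noteq> 0"
proof
  assume "moment_pairing s1 n p = 0"
  then have "orthogonal s1 (Suc n) p"
    using assms(2) by (auto simp: monic_mop_def orthogonal_def less_Suc_eq)
  moreover have "degree p < Suc n + m" "orthogonal s2 m p"
    using assms(2) by (auto simp: monic_mop_def)
  ultimately have "p = 0"
    using perfect_orthogonal_imp_0[OF assms(1)] by blast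
  then show False
    using assms(2) by (simp add: monic_mop_def)
qed


section \<open>Nearest neighbour recurrences\<close>

text \<open>
  This lemma yields both the existence of the polynomials and their recurrence. Multiplying \<open>p\<close>
  by \<open>z\<close> shifts the pairings by one, so \<open>z p\<close> fails to be orthogonal only in three places:
  \<open>\<alpha> q\<close> repairs the pairing \<open>n - 1\<close> for \<open>s1\<close>, \<open>\<beta> r\<close> the pairing \<open>m - 1\<close> for \<open>s2\<close>, and
  then \<open>\<gamma> p\<close> the pairing \<open>n\<close> for \<open>s1\<close>. All divisors are nonzero by
  \<open>monic_mop_pairing_nonzero\<close>. At \<open>n = 0\<close> or \<open>m = 0\<close> the missing neighbour is
  arbitrary and gets the coefficient 0.
\<close>

lemma monic_mop_step:
  assumes perf: "perfect_system s1 s2"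
    and p: "monic_mop s1 s2 n m p"
    and q: "0 < n \<Longrightarrow> monic_mop s1 s2 (n - 1) m q"
    and r: "0 < m \<Longrightarrow> monic_mop s1 s2 n (m - 1) r"
    and \<alpha>: "\<alpha> = (if n = 0 then 0 else moment_pairing s1 n p / moment_pairing s1 (n - 1) q)"
    and \<beta>: "\<beta> = (if m = 0 then 0 else moment_pairing s2 m p / moment_pairing s2 (m - 1) r)"
  shows "\<exists>\<gamma>. monic_mop s1 s2 (Suc n) m (pCons 0 p - smult \<gamma> p - smult \<alpha> q - smult \<beta> r)"
proof -
  have orth_p: "k < n \<Longrightarrow> moment_pairing s1 k p = 0" "k < m \<Longrightarrow> moment_pairing s2 k p = 0" for k
    using p by (auto simp: monic_mop_def orthogonal_def)
  have orth_q: "k < n - 1 \<Longrightarrow> \<alpha> * moment_pairing s1 k q = 0"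
    "k < m \<Longrightarrow> \<alpha> * moment_pairing s2 k q = 0" for k
    using q \<alpha> by (auto simp: monic_mop_def orthogonal_def)
  have orth_r: "k < n \<Longrightarrow> \<beta> * moment_pairing s1 k r = 0"
    "k < m - 1 \<Longrightarrow> \<beta> * moment_pairing s2 k r = 0" for k
    using r \<beta> by (auto simp: monic_mop_def orthogonal_def)
  have cancel1: "moment_pairing s1 n p = \<alpha> * moment_pairing s1 (n - 1) q" if "0 < n"
    using monic_mop_pairing_nonzero[OF perf q[OF that]] that by (simp add: \<alpha>)
  have cancel2: "moment_pairing s2 m p = \<beta> * moment_pairing s2 (m - 1) r" if "0 < m"
    using monic_mop_pairing_nonzero[OF perfect_system_swap[OF perf]] r[OF that] that
    by (simp add: \<beta> monic_mop_swap)
  define \<gamma> where "\<gamma> = (moment_pairing s1 (Suc n) p - \<alpha> * moment_pairing s1 n q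
      - \<beta> * moment_pairing s1 n r) / moment_pairing s1 n p"
  let ?P = "pCons 0 p - smult \<gamma> p - smult \<alpha> q - smult \<beta> r"
  have deg_q: "degree (smult \<alpha> q) \<le> n + m"
  proof (cases "n = 0")
    case False
    then have "degree q \<le> n - 1 + m"
      using q by (auto simp: monic_mop_def)
    then show ?thesis
      using degree_smult_le[of \<alpha> q] by linarith
  qed (simp add: \<alpha>)
  have deg_r: "degree (smult \<beta> r) \<le> n + m"
  proof (cases "m = 0")
    case False
    then have "degree r \<le> n + (m - 1)"
      using r by (auto simp: monic_mop_def)
    then show ?thesis
      using degree_smult_le[of \<beta> r] by linarith
  qed (simp add: \<beta>)
  have deg_p: "degree p \<le> n + m" "coeff p (n + m) = 1"
    using p by (auto simp: monic_mop_def)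
  have "degree ?P \<le> Suc n + m"
    using deg_p deg_q deg_r degree_pCons_le[of 0 p] degree_smult_le[of \<gamma> p]
    by (intro degree_diff_le) linarith+
  moreover have "coeff ?P (Suc n + m) = 1"
  proof -
    have "coeff (smult \<alpha> q) (Suc n + m) = 0" "coeff (smult \<beta> r) (Suc n + m) = 0"
      "coeff p (Suc n + m) = 0"
      using deg_p deg_q deg_r by (auto intro!: coeff_eq_0 simp del: coeff_smult)
    then show ?thesis
      using deg_p by (simp del: coeff_smult) simp
  qed
  moreover have "orthogonal s1 (Suc n) ?P"
    unfolding orthogonal_def
  proof (intro allI impI)
    fix k assume "k < Suc n"
    then consider "k = n" | "0 < n" "k = n - 1" | "k < n - 1" by linarith
    then show "moment_pairing s1 k ?P = 0"
    proof cases
      case 1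
      then show ?thesis
        using monic_mop_pairing_nonzero[OF perf p] by (simp add: moment_pairing_simps \<gamma>_def)
    next
      case 2
      then show ?thesis
        using orth_p(1)[of k] orth_r(1)[of k] cancel1 by (simp add: moment_pairing_simps)
    next
      case 3
      then have "k < n" "Suc k < n"
        by simp_all
      then show ?thesis
        using 3 orth_p(1)[of k] orth_p(1)[of "Suc k"] orth_q(1)[of k] orth_r(1)[of k]
        by (simp add: moment_pairing_simps del: mult_eq_0_iff)
    qed
  qed
  moreover have "orthogonal s2 m ?P"
    unfolding orthogonal_def
  proof (intro allI impI)
    fix k assume k: "k < m"
    show "moment_pairing s2 k ?P = 0"
    proof (cases "Suc k = m")
      case True
      then show ?thesis
        using k orth_p(2)[of k] orth_q(2)[of k] cancel2 by (auto simp: moment_pairing_simps)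
    next
      case False
      then show ?thesis
        using k orth_p(2)[of k] orth_p(2)[of "Suc k"] orth_q(2)[of k] orth_r(2)[of k]
        by (simp add: moment_pairing_simps del: mult_eq_0_iff)
    qed
  qed
  ultimately show ?thesis
    by (auto simp: monic_mop_def)
qed

text \<open>
  The induction covers both systems \<open>(s1, s2)\<close> and \<open>(s2, s1)\<close> at once: for \<open>n = 0\<close> the step is taken
  in the second index, which is the first index of the swapped system.
\<close>

lemma monic_mop_exists:
  assumes "perfect_system s1 s2"
  shows "\<exists>p. monic_mop s1 s2 n m p"
proof -
  have "\<exists>p. monic_mop s1 s2 n m p" if "n + m = N" for n m N
    using that assms
  proof (induction N arbitrary: n m s1 s2 rule: less_induct)
    case (less N)
    have step: "\<exists>p. monic_mop t1 t2 (Suc i) j p"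
      if ij: "Suc i + j = N" and perf: "perfect_system t1 t2" for i j t1 t2
    proof -
      have IH: "\<exists>p. monic_mop t1 t2 i' j' p" if "i' + j' < N" for i' j'
        using less.IH[of "i' + j'" i' j' t1 t2] that perf by blast
      obtain p q r where "monic_mop t1 t2 i j p"
        "0 < i \<Longrightarrow> monic_mop t1 t2 (i - 1) j q" "0 < j \<Longrightarrow> monic_mop t1 t2 i (j - 1) r"
        using IH[of i j] IH[of "i - 1" j] IH[of i "j - 1"] ij by force
      then show ?thesis
        using monic_mop_step[OF perf] by blast
    qed
    show ?case
    proof (cases n)
      case (Suc i)
      then show ?thesis
        using step[of i m s1 s2] less.prems by simp
    next
      case n: 0
      show ?thesis
      proof (cases m)
        case 0
        then show ?thesis
          using n by (intro exI[of _ 1]) (simp add: monic_mop_def orthogonal_def)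
      next
        case (Suc j)
        then show ?thesis
          using step[of j 0 s2 s1] n less.prems perfect_system_swap monic_mop_swap[of s1 s2]
          by simp
      qed
    qed
  qed
  then show ?thesis by blast
qed

definition mop :: "(nat \<Rightarrow> complex) \<Rightarrow> (nat \<Rightarrow> complex) \<Rightarrow> nat \<Rightarrow> nat \<Rightarrow> complex poly" where
  "mop s1 s2 n m = (THE p. monic_mop s1 s2 n m p)"

lemma mop_swap: "mop s2 s1 m n = mop s1 s2 n m"
  by (simp add: mop_def monic_mop_swap[of s2])

lemma monic_mop_mop: "perfect_system s1 s2 \<Longrightarrow> monic_mop s1 s2 n m (mop s1 s2 n m)"
  unfolding mop_def using monic_mop_exists monic_mop_unique by (metis theI')

lemma mop_eqI: "perfect_system s1 s2 \<Longrightarrow> monic_mop s1 s2 n m p \<Longrightarrow> mop s1 s2 n m = p"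
  using monic_mop_unique monic_mop_mop by blast

text \<open>
  The other two recurrence coefficients are obtained by swapping the two systems:
  \<open>b\<^sub>n\<^sub>,\<^sub>m\<close> is \<open>nn_a s2 s1 m n\<close> and \<open>d\<^sub>n\<^sub>,\<^sub>m\<close> is \<open>nn_c s2 s1 m n\<close>.
\<close>

definition nn_a :: "(nat \<Rightarrow> complex) \<Rightarrow> (nat \<Rightarrow> complex) \<Rightarrow> nat \<Rightarrow> nat \<Rightarrow> complex" where
  "nn_a s1 s2 n m = (if n = 0 then 0 else
     moment_pairing s1 n (mop s1 s2 n m) / moment_pairing s1 (n - 1) (mop s1 s2 (n - 1) m))"

text \<open>
  Comparing the coefficients of \<open>z\<^sup>n\<^sup>+\<^sup>m\<close> in the recurrence shows that \<open>c\<^sub>n\<^sub>,\<^sub>m\<close> is the difference of the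
  second highest coefficients of \<open>P\<^sub>n\<^sub>,\<^sub>m\<close> and \<open>P\<^sub>n\<^sub>+\<^sub>1\<^sub>,\<^sub>m\<close>. These are read off after multiplication
  by \<open>z\<close>, so that the value is 0 for the constant polynomial \<open>P\<^sub>0\<^sub>,\<^sub>0\<close>.
\<close>

definition nn_c :: "(nat \<Rightarrow> complex) \<Rightarrow> (nat \<Rightarrow> complex) \<Rightarrow> nat \<Rightarrow> nat \<Rightarrow> complex" where
  "nn_c s1 s2 n m =
     coeff (pCons 0 (mop s1 s2 n m)) (n + m) - coeff (pCons 0 (mop s1 s2 (Suc n) m)) (Suc n + m)"

lemma coeff_mop:
  assumes "perfect_system s1 s2"
  shows "coeff (mop s1 s2 n m) (n + m) = 1" "n + m < k \<Longrightarrow> coeff (mop s1 s2 n m) k = 0"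
  using monic_mop_mop[OF assms, of n m] by (auto simp: monic_mop_def intro: coeff_eq_0)

lemma mop_recurrence:
  assumes perf: "perfect_system s1 s2"
  shows "pCons 0 (mop s1 s2 n m) = mop s1 s2 (Suc n) m + smult (nn_c s1 s2 n m) (mop s1 s2 n m)
    + smult (nn_a s1 s2 n m) (mop s1 s2 (n - 1) m) + smult (nn_a s2 s1 m n) (mop s1 s2 n (m - 1))"
proof -
  obtain \<gamma> where "monic_mop s1 s2 (Suc n) m (pCons 0 (mop s1 s2 n m) - smult \<gamma> (mop s1 s2 n m)
    - smult (nn_a s1 s2 n m) (mop s1 s2 (n - 1) m)
    - smult (nn_a s2 s1 m n) (mop s1 s2 n (m - 1)))"
    using monic_mop_step[OF perf monic_mop_mop[OF perf] monic_mop_mop[OF perf]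
        monic_mop_mop[OF perf] nn_a_def nn_a_def[of s2 s1, unfolded mop_swap[of s2 s1]]]
    by blast
  from mop_eqI[OF perf this]
  have eq: "mop s1 s2 (Suc n) m = pCons 0 (mop s1 s2 n m) - smult \<gamma> (mop s1 s2 n m)
    - smult (nn_a s1 s2 n m) (mop s1 s2 (n - 1) m)
    - smult (nn_a s2 s1 m n) (mop s1 s2 n (m - 1))" .
  have "nn_a s1 s2 n m * coeff (mop s1 s2 (n - 1) m) (n + m) = 0"
    using coeff_mop(2)[OF perf, of "n - 1" m "n + m"] by (cases n) (auto simp: nn_a_def)
  moreover have "nn_a s2 s1 m n * coeff (mop s1 s2 n (m - 1)) (n + m) = 0"
    using coeff_mop(2)[OF perf, of n "m - 1" "n + m"] by (cases m) (auto simp: nn_a_def)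
  ultimately have "coeff (mop s1 s2 (Suc n) m) (n + m)
      = coeff (pCons 0 (mop s1 s2 n m)) (n + m) - \<gamma>"
    using coeff_mop(1)[OF perf, of n m] by (subst eq) (simp del: mult_eq_0_iff)
  then have "\<gamma> = nn_c s1 s2 n m"
    by (simp add: nn_c_def)
  then show ?thesis
    using eq by simp
qed

text \<open>
  Comparison of the coefficients of \<open>z\<^sup>n\<^sup>+\<^sup>m\<^sup>-\<^sup>1\<close> in the recurrence, again after multiplication by a
  power of \<open>z\<close> to avoid negative indices.
\<close>

lemma mop_second_coeff:
  assumes perf: "perfect_system s1 s2"
  shows "nn_a s1 s2 n m + nn_a s2 s1 m n =
    coeff (pCons 0 (pCons 0 (mop s1 s2 n m))) (n + m)
    - coeff (pCons 0 (pCons 0 (mop s1 s2 (Suc n) m))) (Suc n + m)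
    - nn_c s1 s2 n m * coeff (pCons 0 (mop s1 s2 n m)) (n + m)"
proof -
  have 1: "nn_a s1 s2 n m * coeff (pCons 0 (mop s1 s2 (n - 1) m)) (n + m) = nn_a s1 s2 n m"
    using coeff_mop(1)[OF perf, of "n - 1" m] by (cases n) (auto simp: nn_a_def)
  have 2: "nn_a s2 s1 m n * coeff (pCons 0 (mop s1 s2 n (m - 1))) (n + m) = nn_a s2 s1 m n"
    using coeff_mop(1)[OF perf, of n "m - 1"] by (cases m) (auto simp: nn_a_def)
  have "coeff (pCons 0 (pCons 0 (mop s1 s2 n m))) (n + m)
      = coeff (pCons 0 (mop s1 s2 (Suc n) m + smult (nn_c s1 s2 n m) (mop s1 s2 n m)
    + smult (nn_a s1 s2 n m) (mop s1 s2 (n - 1) m)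
    + smult (nn_a s2 s1 m n) (mop s1 s2 n (m - 1)))) (n + m)"
    by (subst mop_recurrence[OF perf]) (rule refl)
  also have "\<dots> = coeff (pCons 0 (mop s1 s2 (Suc n) m)) (n + m)
    + nn_c s1 s2 n m * coeff (pCons 0 (mop s1 s2 n m)) (n + m)
    + nn_a s1 s2 n m * coeff (pCons 0 (mop s1 s2 (n - 1) m)) (n + m)
    + nn_a s2 s1 m n * coeff (pCons 0 (mop s1 s2 n (m - 1))) (n + m)"
    by (cases "n + m") simp_all
  finally show ?thesis
    unfolding 1 2 by simp
qed

text \<open>The terms with \<open>a\<close> and \<open>b\<close> are the same in both recurrences and cancel.\<close>

lemma mop_neighbours:
  assumes perf: "perfect_system s1 s2"
  shows "mop s1 s2 n (Suc m) - mop s1 s2 (Suc n) m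
    = smult (nn_c s1 s2 n m - nn_c s2 s1 m n) (mop s1 s2 n m)"
  using mop_recurrence[OF perf, of n m] mop_recurrence[OF perfect_system_swap[OF perf], of m n]
  by (simp add: mop_swap[of s2 s1] smult_diff_left algebra_simps)

lemma pairing_neighbour:
  assumes perf: "perfect_system s1 s2"
  shows "moment_pairing s1 n (mop s1 s2 n (Suc m))
    = (nn_c s1 s2 n m - nn_c s2 s1 m n) * moment_pairing s1 n (mop s1 s2 n m)"
proof -
  have "moment_pairing s1 n (mop s1 s2 (Suc n) m) = 0"
    using monic_mop_mop[OF perf, of "Suc n" m] by (auto simp: monic_mop_def orthogonal_def)
  then show ?thesis
    using arg_cong[OF mop_neighbours[OF perf, of n m], of "moment_pairing s1 n"]
    by (simp add: moment_pairing_simps)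
qed

lemma mop_pairing_nonzero: "perfect_system s1 s2 \<Longrightarrow> moment_pairing s1 n (mop s1 s2 n m) \<noteq> 0"
  using monic_mop_pairing_nonzero monic_mop_mop by blast

lemma nn_c_neq:
  assumes "perfect_system s1 s2"
  shows "nn_c s1 s2 n m \<noteq> nn_c s2 s1 m n"
  using pairing_neighbour[OF assms, of n m] mop_pairing_nonzero[OF assms] by force

lemma nn_a_equation:
  assumes perf: "perfect_system s1 s2" and n: "1 \<le> n"
  shows "nn_a s1 s2 n (Suc m) = nn_a s1 s2 n m * (nn_c s1 s2 n m - nn_c s2 s1 m n)
    / (nn_c s1 s2 (n - 1) m - nn_c s2 s1 m (n - 1))"
  using n by (simp add: nn_a_def pairing_neighbour[OF perf] mult.commute)

text \<open>
  Let \<open>p\<close> and \<open>q\<close> be the second and third highest coefficients of the polynomials. Then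
  \<open>c\<^sub>n\<^sub>,\<^sub>m = p\<^sub>n\<^sub>,\<^sub>m - p\<^sub>n\<^sub>+\<^sub>1\<^sub>,\<^sub>m\<close> and \<open>d\<^sub>n\<^sub>,\<^sub>m = p\<^sub>n\<^sub>,\<^sub>m - p\<^sub>n\<^sub>,\<^sub>m\<^sub>+\<^sub>1\<close>, so the increments of \<open>c\<close> in the second
  direction and of \<open>d\<close> in the first are the same mixed difference of \<open>p\<close>. The relations for
  \<open>a + b\<close> then express \<open>\<Delta>\<close> as \<open>\<delta>\<close> times that mixed difference.
\<close>

lemma nn_c_d_equations:
  fixes n m :: nat
  assumes perf: "perfect_system s1 s2"
  defines "\<delta> \<equiv> nn_c s1 s2 n m - nn_c s2 s1 m n"
  defines "\<Delta> \<equiv> (nn_a s1 s2 (Suc n) m + nn_a s2 s1 m (Suc n))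
    - (nn_a s1 s2 n (Suc m) + nn_a s2 s1 (Suc m) n)"
  shows "nn_c s1 s2 n (Suc m) = nn_c s1 s2 n m + \<Delta> / \<delta>"
    and "nn_c s2 s1 m (Suc n) = nn_c s2 s1 m n + \<Delta> / \<delta>"
proof -
  note perf' = perfect_system_swap[OF perf]
  define p where "p i j = coeff (pCons 0 (mop s1 s2 i j)) (i + j)" for i j
  define q where "q i j = coeff (pCons 0 (pCons 0 (mop s1 s2 i j))) (i + j)" for i j
  have c: "nn_c s1 s2 i j = p i j - p (Suc i) j" for i j
    by (simp only: nn_c_def p_def)
  have d: "nn_c s2 s1 j i = p i j - p i (Suc j)" for i j
    by (simp only: nn_c_def p_def mop_swap[of s2 s1] add.commute[of j] add.commute[of "Suc j"])
  have ab_c: "nn_a s1 s2 i j + nn_a s2 s1 j i = q i j - q (Suc i) j - nn_c s1 s2 i j * p i j" for i j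
    unfolding p_def q_def by (rule mop_second_coeff[OF perf])
  have ab_d: "nn_a s1 s2 i j + nn_a s2 s1 j i = q i j - q i (Suc j) - nn_c s2 s1 j i * p i j" for i j
    using mop_second_coeff[OF perf', of j i]
    by (simp only: q_def p_def mop_swap[of s2 s1] add.commute[of j] add.commute[of "Suc j"]
        add.commute[of "nn_a s2 s1 j i"])
  have neq: "\<delta> \<noteq> 0"
    using nn_c_neq[OF perf] by (simp add: \<delta>_def)
  \<comment> \<open>The two expansions are chosen to have the same term \<open>q (Suc n) (Suc m)\<close>, which cancels.\<close>
  have "\<Delta> = (q (Suc n) m - q n (Suc m)) - nn_c s2 s1 m (Suc n) * p (Suc n) m
      + nn_c s1 s2 n (Suc m) * p n (Suc m)"
    unfolding \<Delta>_def ab_d[of "Suc n" m] ab_c[of n "Suc m"] by simp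
  also have "q (Suc n) m - q n (Suc m) = - \<delta> * p n m"
    using ab_c[of n m] ab_d[of n m] by (simp add: \<delta>_def algebra_simps)
  finally have "\<Delta> = (p n (Suc m) - p (Suc n) (Suc m) - p n m + p (Suc n) m) * \<delta>"
    unfolding \<delta>_def c d by (simp add: algebra_simps)
  then have "\<Delta> / \<delta> = p n (Suc m) - p (Suc n) (Suc m) - p n m + p (Suc n) m"
    using neq by simp
  then show "nn_c s1 s2 n (Suc m) = nn_c s1 s2 n m + \<Delta> / \<delta>"
    and "nn_c s2 s1 m (Suc n) = nn_c s2 s1 m n + \<Delta> / \<delta>"
    by (simp_all add: c d)
qed

lemma nn_difference_equations:
  assumes perf: "perfect_system s1 s2"
  shows "difference_equations (nn_a s1 s2) (\<lambda>n m. nn_a s2 s1 m n)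
    (nn_c s1 s2) (\<lambda>n m. nn_c s2 s1 m n)"
proof -
  note perf' = perfect_system_swap[OF perf]
  have b: "nn_a s2 s1 m (Suc n) = nn_a s2 s1 m n * (nn_c s1 s2 n m - nn_c s2 s1 m n)
      / (nn_c s1 s2 n (m - 1) - nn_c s2 s1 (m - 1) n)" if "1 \<le> m" for n m
  proof -
    have "x * (u - v) / (w - y) = x * (v - u) / (y - w)" for x u v w y :: complex
      by (metis minus_diff_eq minus_divide_divide mult_minus_right)
    then show ?thesis
      using nn_a_equation[OF perf' that, of n] by metis
  qed
  show ?thesis
    unfolding difference_equations_def Suc_eq_plus1[symmetric]
    using nn_c_neq[OF perf] nn_c_d_equations[OF perf] nn_a_equation[OF perf] b by simp
qed

section \<open>J-fractions\<close>

text \<open>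
  Unlike \<open>bigo_at_inf\<close>, the order may be negative here; polynomials of degree \<open>n\<close> have order at least
  \<open>- n\<close>.
\<close>

definition order_at_inf_ge :: "complex fls \<Rightarrow> int \<Rightarrow> bool" where
  "order_at_inf_ge f k \<longleftrightarrow> (\<forall>i<k. fls_nth f i = 0)"

lemma order_at_inf_ge_iff: "order_at_inf_ge f k \<longleftrightarrow> f = 0 \<or> k \<le> fls_subdegree f"
  by (auto simp: order_at_inf_ge_def intro: fls_subdegree_geI)

lemma order_at_inf_ge_mult:
  "order_at_inf_ge f j \<Longrightarrow> order_at_inf_ge g k \<Longrightarrow> order_at_inf_ge (f * g) (j + k)"
  unfolding order_at_inf_ge_iff by (cases "f = 0 \<or> g = 0") auto

lemma order_at_inf_ge_const: "order_at_inf_ge (fls_const r) 0"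
  by (simp add: order_at_inf_ge_def)

lemma order_at_inf_ge_poly: "degree p \<le> n \<Longrightarrow> order_at_inf_ge (poly_at_inf p) (- int n)"
  by (auto simp: order_at_inf_ge_def poly_at_inf_nth intro!: coeff_eq_0)

lemma jfrac_denominator:
  assumes "order_at_inf_ge J 1"
  shows "fls_X_inv - fls_const c - fls_const a * J \<noteq> 0"
    "order_at_inf_ge (1 / (fls_X_inv - fls_const c - fls_const a * J)) 1"
proof -
  let ?X = "fls_X_inv - fls_const c - fls_const a * J"
  have nth: "fls_nth ?X (- 1) = 1" "\<And>i. i < - 1 \<Longrightarrow> fls_nth ?X i = 0"
    using assms by (auto simp: order_at_inf_ge_def)
  show "?X \<noteq> 0"
    using nth(1) by (metis fls_zero_nth zero_neq_one)
  have "fls_subdegree ?X = - 1"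
    using nth by (intro fls_subdegree_eqI) auto
  then have "fls_subdegree (inverse ?X) = 1"
    by (simp add: fls_inverse_subdegree)
  then show "order_at_inf_ge (1 / ?X) 1"
    by (simp add: order_at_inf_ge_iff divide_inverse)
qed

lemma jfrac_order: "order_at_inf_ge (jfrac c a k n) 1"
proof (induction n arbitrary: k)
  case (Suc n)
  then show ?case using jfrac_denominator(2) by simp
qed (simp add: order_at_inf_ge_def)

text \<open>
  Each level of the fraction gains two orders, since the difference \<open>1 / X - 1 / Y\<close> is
  \<open>(Y - X) / (X Y)\<close> and \<open>X\<close>, \<open>Y\<close> both behave like \<open>z\<close>.
\<close>

lemma jfrac_order_diff:
  "order_at_inf_ge (jfrac c a k (n + j) - jfrac c a k n) (2 * int n + 1)"
proof (induction n arbitrary: k)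
  case 0
  then show ?case using jfrac_order by simp
next
  case (Suc n)
  let ?J = "jfrac c a (Suc k) (n + j)" and ?K = "jfrac c a (Suc k) n"
  let ?X = "fls_X_inv - fls_const (c k) - fls_const (a (Suc k)) * ?J"
  let ?Y = "fls_X_inv - fls_const (c k) - fls_const (a (Suc k)) * ?K"
  have "?X \<noteq> 0" "?Y \<noteq> 0"
    using jfrac_denominator(1) jfrac_order by blast+
  then have "1 / ?X - 1 / ?Y = (fls_const (a (Suc k)) * (?J - ?K)) * (1 / ?X) * (1 / ?Y)"
    by (simp add: field_simps)
  moreover have "order_at_inf_ge ((fls_const (a (Suc k)) * (?J - ?K)) * (1 / ?X) * (1 / ?Y))
      (0 + (2 * int n + 1) + 1 + 1)"
    using Suc.IH jfrac_denominator(2) jfrac_order order_at_inf_ge_const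
    by (intro order_at_inf_ge_mult) blast+
  moreover have "0 + (2 * int n + 1) + 1 + 1 = 2 * int (Suc n) + 1"
    by simp
  ultimately show ?case by (simp only: add_Suc jfrac.simps)
qed

lemma fls_LIMSEQ_coeffs_agree:
  fixes f :: "nat \<Rightarrow> complex fls"
  assumes "f \<longlonglongrightarrow> g"
  shows "eventually (\<lambda>n. order_at_inf_ge (f n - g) (int N)) sequentially"
proof -
  have "eventually (\<lambda>n. dist (f n) g < inverse (2 ^ N)) sequentially"
    using assms by (rule tendstoD) simp
  then show ?thesis
  proof eventually_elim
    case (elim n)
    show ?case
    proof (rule ccontr)
      assume "\<not> order_at_inf_ge (f n - g) (int N)"
      then have ne: "f n \<noteq> g" and sub: "fls_subdegree (f n - g) < int N"
        by (auto simp: order_at_inf_ge_iff)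
      have "inverse (2 ^ N) \<le> dist (f n) g"
      proof (cases "0 \<le> fls_subdegree (f n - g)")
        case True
        then have "nat (fls_subdegree (f n - g)) \<le> N" using sub by simp
        then have "(2::real) ^ nat (fls_subdegree (f n - g)) \<le> 2 ^ N"
          by (intro power_increasing) auto
        then show ?thesis
          using True ne by (simp add: dist_fls_def le_imp_inverse_le)
      next
        case False
        have "inverse (2 ^ N) \<le> (1::real)" by (simp add: inverse_le_1_iff)
        also have "\<dots> \<le> 2 ^ nat (- fls_subdegree (f n - g))" by simp
        finally show ?thesis using False ne by (simp add: dist_fls_def)
      qed
      with elim show False by simp
    qed
  qed
qed

lemma jfraction_rep_order:
  assumes "jfraction_rep s c a"
  shows "order_at_inf_ge (moment_series s + jfrac c a 0 n) (2 * int n + 1)"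
proof -
  have "eventually (\<lambda>N. order_at_inf_ge (- jfrac c a 0 N - moment_series s) (int (2 * n + 1)))
      sequentially"
    using assms by (intro fls_LIMSEQ_coeffs_agree) (simp add: jfraction_rep_def)
  then obtain N where N: "\<And>j. j \<ge> N \<Longrightarrow>
      order_at_inf_ge (- jfrac c a 0 j - moment_series s) (int (2 * n + 1))"
    by (auto simp: eventually_sequentially)
  have "moment_series s + jfrac c a 0 n = - (- jfrac c a 0 (n + N) - moment_series s)
      - (jfrac c a 0 (n + N) - jfrac c a 0 n)"
    by simp
  then show ?thesis
    using N[of "n + N"] jfrac_order_diff[of c a 0 n N]
    by (simp only: order_at_inf_ge_def fls_minus_nth fls_uminus_nth) simp
qed

text \<open>
  These are the continuants of the J-fraction: \<open>jden c a k n\<close> is the denominator of the fraction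
  \<open>jfrac c a k n\<close>, and its numerator is \<open>jden c a (k + 1) (n - 1)\<close> for positive \<open>n\<close>. The recursion
  removes the outermost level, as \<open>jfrac\<close> does.
\<close>

fun jden :: "(nat \<Rightarrow> complex) \<Rightarrow> (nat \<Rightarrow> complex) \<Rightarrow> nat \<Rightarrow> nat \<Rightarrow> complex poly" where
  "jden c a k 0 = 1"
| "jden c a k (Suc 0) = [:- c k, 1:]"
| "jden c a k (Suc (Suc n)) = [:- c k, 1:] * jden c a (Suc k) (Suc n)
     - smult (a (Suc k)) (jden c a (Suc (Suc k)) n)"

lemma jfrac_mult_jden:
  "jfrac c a k (Suc n) * poly_at_inf (jden c a k (Suc n)) = poly_at_inf (jden c a (Suc k) n)"
proof (induction n arbitrary: k)
  case 0
  have "poly_at_inf [:- c k, 1:] = fls_X_inv - fls_const (c k)"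
    using poly_at_inf_linear_mult[of "c k" 1] by (simp add: poly_at_inf_pCons one_pCons)
  then show ?case
    using jfrac_denominator(1)[OF jfrac_order[of c a k 0], of "c k" 0]
    by (simp add: poly_at_inf_pCons one_pCons)
next
  case (Suc n)
  let ?J = "jfrac c a (Suc k) (Suc n)"
  let ?X = "fls_X_inv - fls_const (c k) - fls_const (a (Suc k)) * ?J"
  have X: "?X \<noteq> 0"
    using jfrac_denominator(1) jfrac_order by blast
  have "poly_at_inf (jden c a k (Suc (Suc n))) = (fls_X_inv - fls_const (c k)) *
      poly_at_inf (jden c a (Suc k) (Suc n)) - fls_const (a (Suc k)) *
      poly_at_inf (jden c a (Suc (Suc k)) n)"
    by (simp only: jden.simps poly_at_inf_diff poly_at_inf_smult poly_at_inf_linear_mult)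
  also have "\<dots> = ?X * poly_at_inf (jden c a (Suc k) (Suc n))"
    unfolding Suc.IH[symmetric] by (simp only: left_diff_distrib mult.assoc)
  finally have "poly_at_inf (jden c a k (Suc (Suc n))) =
      ?X * poly_at_inf (jden c a (Suc k) (Suc n))" .
  moreover have "jfrac c a k (Suc (Suc n)) = 1 / ?X"
    by (rule jfrac.simps)
  ultimately show ?case
    using X by (simp only: times_divide_eq_left mult_1_left nonzero_mult_div_cancel_left
        if_False not_False_eq_True)
qed

lemma degree_jden: "degree (jden c a k n) \<le> n"
  and coeff_jden: "coeff (jden c a k n) n = 1"
proof (induction c a k n rule: jden.induct)
  case (3 c a k n)
  have "degree ([:- c k, 1:] * jden c a (Suc k) (Suc n)) \<le> Suc (Suc n)"
    using degree_mult_le[of "[:- c k, 1:]" "jden c a (Suc k) (Suc n)"] 3(1) by simp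
  moreover have "degree (smult (a (Suc k)) (jden c a (Suc (Suc k)) n)) \<le> Suc (Suc n)"
    using degree_smult_le 3(3) by (meson le_SucI order_trans)
  ultimately show "degree (jden c a k (Suc (Suc n))) \<le> Suc (Suc n)"
    unfolding jden.simps by (rule degree_diff_le)
  have "coeff (jden c a (Suc k) (Suc n)) (Suc (Suc n)) = 0"
    "coeff (jden c a (Suc (Suc k)) n) (Suc (Suc n)) = 0"
    using 3(1,3) by (auto intro!: coeff_eq_0)
  then show "coeff (jden c a k (Suc (Suc n))) (Suc (Suc n)) = 1"
    using 3(2) by simp
qed auto

text \<open>
  Continuants can also be expanded at the innermost level. This form keeps \<open>k\<close> fixed and has the
  shape of the recurrence for orthogonal polynomials.
\<close>

lemma jden_forward:
  "jden c a k (Suc (Suc n)) = [:- c (k + Suc n), 1:] * jden c a k (Suc n)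
     - smult (a (k + Suc n)) (jden c a k n)"
proof (induction n arbitrary: k rule: less_induct)
  case (less n)
  consider "n = 0" | "n = 1" | i where "n = Suc (Suc i)"
    by (metis One_nat_def not0_implies_Suc)
  then show ?case
  proof cases
    case 1
    then show ?thesis by (simp add: algebra_simps)
  next
    case 2
    then show ?thesis
      by (simp add: algebra_simps smult_add_right smult_diff_right)
  next
    case 3
    have IH1: "jden c a (Suc k) (Suc n) = [:- c (k + Suc n), 1:] * jden c a (Suc k) n
     - smult (a (k + Suc n)) (jden c a (Suc k) (Suc i))"
      using less.IH[of "Suc i" "Suc k"] 3 by simp
    have IH2: "jden c a (Suc (Suc k)) n = [:- c (k + Suc n), 1:] * jden c a (Suc (Suc k)) (Suc i)
     - smult (a (k + Suc n)) (jden c a (Suc (Suc k)) i)"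
      using less.IH[of i "Suc (Suc k)"] 3 by simp
    have e1: "jden c a k (Suc n) = [:- c k, 1:] * jden c a (Suc k) n
        - smult (a (Suc k)) (jden c a (Suc (Suc k)) (Suc i))"
      and e2: "jden c a k n = [:- c k, 1:] * jden c a (Suc k) (Suc i)
        - smult (a (Suc k)) (jden c a (Suc (Suc k)) i)"
      using 3 jden.simps(3) by auto
    have ring: "L * (M * x - smult r y) - smult t (M * u - smult r v)
        = M * (L * x - smult t u) - smult r (L * y - smult t v)"
      for L M x y u v :: "complex poly" and r t
      by (simp add: algebra_simps smult_diff_right)
    show ?thesis
      unfolding jden.simps(3)[of c a k n] IH1 IH2 e1 e2 by (rule ring)
  qed
qed

text \<open>
  Multiplying \<open>f + jfrac c a 0 n = O(z\<^sup>-\<^sup>2\<^sup>n\<^sup>-\<^sup>1)\<close> by the denominator of degree \<open>n\<close> leaves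
  \<open>O(z\<^sup>-\<^sup>n\<^sup>-\<^sup>1)\<close>, and turns the convergent into a polynomial.
\<close>

lemma jden_orthogonal:
  assumes "jfraction_rep s c a"
  shows "orthogonal s n (jden c a 0 n)"
  unfolding orthogonal_def
proof (intro allI impI)
  fix k assume k: "k < n"
  then obtain n' where n: "n = Suc n'"
    by (cases n) auto
  let ?D = "poly_at_inf (jden c a 0 n)"
  have "order_at_inf_ge ((moment_series s + jfrac c a 0 n) * ?D) ((2 * int n + 1) + (- int n))"
    using jfraction_rep_order[OF assms] order_at_inf_ge_poly[OF degree_jden]
    by (rule order_at_inf_ge_mult)
  then have "fls_nth ((moment_series s + jfrac c a 0 n) * ?D) (int k + 1) = 0"
    using k by (simp add: order_at_inf_ge_def)
  moreover have "(moment_series s + jfrac c a 0 n) * ?D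
      = moment_series s * ?D + poly_at_inf (jden c a (Suc 0) n')"
    unfolding n by (simp only: distrib_right jfrac_mult_jden)
  ultimately show "moment_pairing s k (jden c a 0 n) = 0"
    by (simp add: moment_pairing_def poly_at_inf_nth)
qed

text \<open>
  The continuants are the polynomials \<open>P\<^sub>n\<^sub>,\<^sub>0\<close>, so both satisfy the same three-term recurrence, whose
  coefficients are unique because consecutive polynomials have different degrees.
\<close>

lemma nn_boundary:
  assumes perf: "perfect_system s1 s2" and rep: "jfraction_rep s1 c a"
  shows "nn_c s1 s2 n 0 = c n" "nn_a s1 s2 (Suc n) 0 = a (Suc n)"
proof -
  have D: "mop s1 s2 n 0 = jden c a 0 n" for n
    using jden_orthogonal[OF rep] degree_jden coeff_jden
    by (intro mop_eqI[OF perf]) (simp add: monic_mop_def orthogonal_def)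
  have b: "nn_a s2 s1 0 n = 0" for n
    by (simp add: nn_a_def)
  have rec: "smult (nn_c s1 s2 (Suc n) 0 - c (Suc n)) (jden c a 0 (Suc n))
      + smult (nn_a s1 s2 (Suc n) 0 - a (Suc n)) (jden c a 0 n) = 0" for n
    using mop_recurrence[OF perf, of "Suc n" 0] jden_forward[of c a 0 n]
    by (simp add: D b smult_diff_left algebra_simps)
  have cc: "nn_c s1 s2 (Suc n) 0 = c (Suc n)" for n
    using arg_cong[OF rec[of n], of "\<lambda>p. coeff p (Suc n)"] coeff_jden[of c a 0 "Suc n"]
      degree_jden[of c a 0 n] by (simp add: coeff_eq_0)
  show "nn_a s1 s2 (Suc n) 0 = a (Suc n)"
    using arg_cong[OF rec[of n], of "\<lambda>p. coeff p n"] coeff_jden[of c a 0 n] cc[of n] by simp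
  have "nn_c s1 s2 0 0 = c 0"
    unfolding nn_c_def D by simp
  then show "nn_c s1 s2 n 0 = c n"
    using cc by (cases n) auto
qed

section \<open>The boundary value problem\<close>

text \<open>
  The induction is over the antidiagonals \<open>n + m = N\<close>. The values of \<open>c, d\<close> on the next one need
  \<open>a, b\<close> there, and the values of \<open>a, b\<close> need \<open>c, d\<close> only on the two antidiagonals before; hence
  \<open>a, b\<close> are carried one antidiagonal ahead of \<open>c, d\<close>.
\<close>

lemma bvp_solution_unique:
  assumes "bvp_solution chat dhat ahat bhat a b c d"
    and "bvp_solution chat dhat ahat bhat a' b' c' d'"
  shows "a' = a \<and> b' = b \<and> c' = c \<and> d' = d"
proof -
  let ?AB = "\<lambda>N. \<forall>n m. n + m = N \<longrightarrow> a' n m = a n m \<and> b' n m = b n m"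
  let ?CD = "\<lambda>N. \<forall>n m. n + m = N \<longrightarrow> c' n m = c n m \<and> d' n m = d n m"
  have bc: "a 0 m = 0" "d 0 m = dhat m" "b 0 (Suc m) = bhat (Suc m)"
    "b n 0 = 0" "c n 0 = chat n" "a (Suc n) 0 = ahat (Suc n)"
    "a' 0 m = 0" "d' 0 m = dhat m" "b' 0 (Suc m) = bhat (Suc m)"
    "b' n 0 = 0" "c' n 0 = chat n" "a' (Suc n) 0 = ahat (Suc n)" for n m
    using assms by (auto simp: bvp_solution_def boundary_conditions_def)
  note de = assms[unfolded bvp_solution_def difference_equations_def Suc_eq_plus1[symmetric]]
  have a_eq: "a' (Suc n) (Suc m) = a (Suc n) (Suc m)"
    if "?AB (Suc (n + m))" "?CD (Suc (n + m))" "?CD (n + m)" for n m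
    using de that by simp
  have b_eq: "b' (Suc n) (Suc m) = b (Suc n) (Suc m)"
    if "?AB (Suc (n + m))" "?CD (Suc (n + m))" "?CD (n + m)" for n m
    using de that by simp
  have c_eq: "c' n (Suc m) = c n (Suc m)" "d' (Suc n) m = d (Suc n) m"
    if "?AB (Suc (n + m))" "?CD (n + m)" for n m
    using de that by simp_all
  have "?AB N \<and> ?AB (Suc N) \<and> ?CD N" for N
  proof (induction N)
    case 0
    show ?case
      using bc(3,6,9,12)[of 0] by (auto simp: bc add_is_1)
  next
    case (Suc N)
    have CD: "?CD (Suc N)"
    proof (intro allI impI)
      fix n m assume nm: "n + m = Suc N"
      show "c' n m = c n m \<and> d' n m = d n m"
      proof
        show "c' n m = c n m"
          using nm c_eq(1)[of n "m - 1"] Suc by (cases m) (auto simp: bc)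
        show "d' n m = d n m"
          using nm c_eq(2)[of "n - 1" m] Suc by (cases n) (auto simp: bc)
      qed
    qed
    have "a' n m = a n m \<and> b' n m = b n m" if nm: "n + m = Suc (Suc N)" for n m
    proof (cases n)
      case 0
      then show ?thesis using nm by (simp add: bc)
    next
      case n: (Suc i)
      show ?thesis
      proof (cases m)
        case 0
        then show ?thesis using n by (simp add: bc)
      next
        case m: (Suc j)
        have "i + j = N" using nm n m by simp
        then show ?thesis
          unfolding n m using a_eq[of i j] b_eq[of i j] Suc CD by blast
      qed
    qed
    then show ?case using CD Suc by blast
  qed
  then show ?thesis by (intro conjI ext) blast+
qed

lemma nn_bvp_solution:
  assumes "corresponds_to_perfect_system chat dhat ahat bhat s1 s2"
  shows "bvp_solution chat dhat ahat bhat (nn_a s1 s2) (\<lambda>n m. nn_a s2 s1 m n)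
    (nn_c s1 s2) (\<lambda>n m. nn_c s2 s1 m n)"
proof -
  have perf: "perfect_system s1 s2"
    and rep: "jfraction_rep s1 chat ahat" "jfraction_rep s2 dhat bhat"
    using assms by (auto simp: corresponds_to_perfect_system_def)
  show ?thesis
    using nn_difference_equations[OF perf] nn_boundary[OF perf rep(1)]
      nn_boundary[OF perfect_system_swap[OF perf] rep(2)]
    by (simp add: bvp_solution_def boundary_conditions_def) (simp add: nn_a_def)
qed

text \<open>
  A J-fraction representation leaves the entries \<open>ahat 0\<close> and \<open>bhat 0\<close> open, so data with the same
  moments agree only from index 1 on.
\<close>

lemma bvp_solution_cong:
  assumes "\<And>n. ahat (Suc n) = ahat' (Suc n)" "\<And>m. bhat (Suc m) = bhat' (Suc m)"
  shows "bvp_solution chat dhat ahat bhat a b c d \<longleftrightarrow> bvp_solution chat dhat ahat' bhat' a b c d"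
  using assms by (simp add: bvp_solution_def boundary_conditions_def)

lemma moment_series_inject: "moment_series s = moment_series t \<Longrightarrow> s = t"
proof
  fix k assume "moment_series s = moment_series t"
  then have "fls_nth (moment_series s) (int (Suc k)) = fls_nth (moment_series t) (int (Suc k))"
    by simp
  then show "s k = t k"
    unfolding moment_series_def fps_to_fls_nth nat_int by simp
qed

lemma jfraction_rep_moments_unique:
  "jfraction_rep s c a \<Longrightarrow> jfraction_rep t c a \<Longrightarrow> s = t"
  unfolding jfraction_rep_def by (blast intro: moment_series_inject LIMSEQ_unique)

theorem proposition5p1:
  fixes chat dhat ahat bhat s1 s2 :: "nat \<Rightarrow> complex"
  assumes "corresponds_to_perfect_system chat dhat ahat bhat s1 s2"
  shows "(\<exists>a b c d. bvp_solution chat dhat ahat bhat a b c d) \<and>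
    (\<forall>a b c d. bvp_solution chat dhat ahat bhat a b c d \<longrightarrow>
       (\<forall>n. a (n + 1) 0 = ahat (n + 1) \<and> ahat (n + 1) \<noteq> 0) \<and>
       (\<forall>m. b 0 (m + 1) = bhat (m + 1) \<and> bhat (m + 1) \<noteq> 0)) \<and>
    (\<forall>t1 t2. corresponds_to_perfect_system chat dhat ahat bhat t1 t2 \<longrightarrow>
       t1 = s1 \<and> t2 = s2) \<and>
    (\<forall>chat' dhat' ahat' bhat' a b c d a' b' c' d'.
       corresponds_to_perfect_system chat' dhat' ahat' bhat' s1 s2 \<and>
       bvp_solution chat dhat ahat bhat a b c d \<and>
       bvp_solution chat' dhat' ahat' bhat' a' b' c' d' \<longrightarrow>
       a' = a \<and> b' = b \<and> c' = c \<and> d' = d)"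
proof (intro conjI)
  let ?corr = corresponds_to_perfect_system
  show "\<exists>a b c d. bvp_solution chat dhat ahat bhat a b c d"
    using nn_bvp_solution[OF assms] by blast
  show "\<forall>a b c d. bvp_solution chat dhat ahat bhat a b c d \<longrightarrow>
       (\<forall>n. a (n + 1) 0 = ahat (n + 1) \<and> ahat (n + 1) \<noteq> 0) \<and>
       (\<forall>m. b 0 (m + 1) = bhat (m + 1) \<and> bhat (m + 1) \<noteq> 0)"
    using assms by (simp add: corresponds_to_perfect_system_def jfraction_rep_def
        bvp_solution_def boundary_conditions_def)
  show "\<forall>t1 t2. ?corr chat dhat ahat bhat t1 t2 \<longrightarrow> t1 = s1 \<and> t2 = s2"
    using assms jfraction_rep_moments_unique unfolding corresponds_to_perfect_system_def by blast
  show "\<forall>chat' dhat' ahat' bhat' a b c d a' b' c' d'.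
       ?corr chat' dhat' ahat' bhat' s1 s2 \<and>
       bvp_solution chat dhat ahat bhat a b c d \<and>
       bvp_solution chat' dhat' ahat' bhat' a' b' c' d' \<longrightarrow>
       a' = a \<and> b' = b \<and> c' = c \<and> d' = d"
  proof (intro allI impI, elim conjE)
    fix chat' dhat' ahat' bhat' a b c d a' b' c' d'
    assume corr': "?corr chat' dhat' ahat' bhat' s1 s2"
      and sol: "bvp_solution chat dhat ahat bhat a b c d"
      and sol': "bvp_solution chat' dhat' ahat' bhat' a' b' c' d'"
    have perf: "perfect_system s1 s2" "perfect_system s2 s1"
      using assms perfect_system_swap by (auto simp: corresponds_to_perfect_system_def)
    have rep: "jfraction_rep s1 chat ahat" "jfraction_rep s2 dhat bhat"
      "jfraction_rep s1 chat' ahat'" "jfraction_rep s2 dhat' bhat'"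
      using assms corr' by (auto simp: corresponds_to_perfect_system_def)
    have "chat' = chat" "\<And>n. ahat' (Suc n) = ahat (Suc n)"
      using nn_boundary[OF perf(1) rep(1)] nn_boundary[OF perf(1) rep(3)] by auto
    moreover have "dhat' = dhat" "\<And>n. bhat' (Suc n) = bhat (Suc n)"
      using nn_boundary[OF perf(2) rep(2)] nn_boundary[OF perf(2) rep(4)] by auto
    ultimately have "bvp_solution chat dhat ahat bhat a' b' c' d'"
      using sol' bvp_solution_cong[of ahat' ahat bhat' bhat] by simp
    then show "a' = a \<and> b' = b \<and> c' = c \<and> d' = d"
      using bvp_solution_unique[OF sol] by blast
  qed
qed

end
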